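(* Let $G_1^{u_1}$ and $G_2^{u_2}$ be two rooted graphs, where $G_1$ and $G_2$ are nontrivial connected graphs. If $G_1$ is not a path with an end-vertex $u_1$ (i.e. it is not the case that $G_1$ is a path having $u_1$ as one of its end-vertices), then $$\dim(G_2^{u_2}\sqcap G_1^{u_1})=|V(G_2)|\cdot\mathrm{rdim}(G_1^{u_1}).$$
   Context: All graphs are finite, simple, nontrivial (at least two vertices) and connected. For a graph $G$, $V(G)$ and $E(G)$ are its vertex and edge sets and $d_G(u,v)$ is the distance between $u$ and $v$. Put $R_G\{u,v\}=\{w\in V(G) : d_G(u,w)\neq d_G(v,w)\}$. A subset $W\subseteq V(G)$ is a resolving set of $G$ if $W\cap R_G\{u,v\}\neq\emptyset$ for any two distinct vertices $u,v$ of $G$. The metric dimension $\dim(G)$ is the minimum cardinality of a resolving set of $G$. A rooted graph $G^u$ is a graph $G$ with a distinguished vertex $u$, its root. A rooted resolving set of $G^u$ is a subset $W\subseteq V(G)$ such that $W\cup\{u\}$ is a resolving set of $G$; the rooted metric dimension $\mathrm{rdim}(G^u)$ is the minimum cardinality of a rooted resolving set of $G^u$. The hierarchical product $G_2^{u_2}\sqcap G_1^{u_1}$ of rooted graphs is the rooted graph with vertex set $\{x_2x_1 : x_i\in V(G_i), i=1,2\}$ (pairs), root $u_2u_1$, in which $x_2x_1$ is adjacent to $y_2y_1$ whenever $x_2=y_2$ and $\{x_1,y_1\}\in E(G_1)$, or $x_1=y_1=u_1$ and $\{x_2,y_2\}\in E(G_2)$. The metric dimension of a rooted graph is that of the underlying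 graph. *)

theory Defs
  imports "Graph_Theory.Graph_Theory"
begin

text \<open>
  A simple graph is a \<^locale>\<open>pair_graph\<close>: a finite, loop-free, symmetric digraph whose arcs are
  pairs of vertices.  An edge \<open>{x, y}\<close> is represented by the two arcs \<open>(x, y)\<close> and \<open>(y, x)\<close>.
\<close>

definition nontrivial_connected_graph :: "'a pair_pre_digraph \<Rightarrow> bool" where
  "nontrivial_connected_graph G \<longleftrightarrow>
     pair_graph G \<and> connected (with_proj G) \<and> 2 \<le> card (pverts G)"

text \<open>
  With unit weights the cost of a walk is its length, so \<open>\<mu>\<close> is the usual distance; it is finite
  whenever the graph is connected.
\<close>

definition graph_dist :: "'a pair_pre_digraph \<Rightarrow> 'a \<Rightarrow> 'a \<Rightarrow> ereal" where
  "graph_dist G u v = wf_digraph.\<mu> (with_proj G) (\<lambda>_. 1) u v"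

definition resolvers :: "'a pair_pre_digraph \<Rightarrow> 'a \<Rightarrow> 'a \<Rightarrow> 'a set" where
  "resolvers G u v = {w \<in> pverts G. graph_dist G u w \<noteq> graph_dist G v w}"

definition resolving_set :: "'a pair_pre_digraph \<Rightarrow> 'a set \<Rightarrow> bool" where
  "resolving_set G W \<longleftrightarrow> W \<subseteq> pverts G \<and>
     (\<forall>u\<in>pverts G. \<forall>v\<in>pverts G. u \<noteq> v \<longrightarrow> W \<inter> resolvers G u v \<noteq> {})"

definition metric_dim :: "'a pair_pre_digraph \<Rightarrow> nat" where
  "metric_dim G = (LEAST n. \<exists>W. resolving_set G W \<and> card W = n)"

type_synonym 'a rooted_graph = "'a pair_pre_digraph \<times> 'a"

definition underlying :: "'a rooted_graph \<Rightarrow> 'a pair_pre_digraph" where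
  "underlying = fst"

definition graph_root :: "'a rooted_graph \<Rightarrow> 'a" where
  "graph_root = snd"

definition rooted_resolving_set :: "'a rooted_graph \<Rightarrow> 'a set \<Rightarrow> bool" where
  "rooted_resolving_set R W \<longleftrightarrow>
     W \<subseteq> pverts (underlying R) \<and> resolving_set (underlying R) (W \<union> {graph_root R})"

definition rooted_metric_dim :: "'a rooted_graph \<Rightarrow> nat" where
  "rooted_metric_dim R = (LEAST n. \<exists>W. rooted_resolving_set R W \<and> card W = n)"

definition hierarchical_product ::
    "'b rooted_graph \<Rightarrow> 'a rooted_graph \<Rightarrow> ('b \<times> 'a) rooted_graph" where
  "hierarchical_product R2 R1 =
     (\<lparr> pverts = pverts (underlying R2) \<times> pverts (underlying R1),
        parcs = {((x2, x1), (y2, y1)) | x2 x1 y2 y1.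
            x2 \<in> pverts (underlying R2) \<and> x2 = y2 \<and> (x1, y1) \<in> parcs (underlying R1) \<or>
            x1 = graph_root R1 \<and> y1 = graph_root R1 \<and> (x2, y2) \<in> parcs (underlying R2)} \<rparr>,
      (graph_root R2, graph_root R1))"

text \<open>
  The list \<open>p\<close> enumerates the vertices of the path graph \<open>G\<close> in order; the edges of \<open>G\<close> are
  exactly those between consecutive vertices of \<open>p\<close>.
\<close>

definition path_graph_along :: "'a pair_pre_digraph \<Rightarrow> 'a list \<Rightarrow> bool" where
  "path_graph_along G p \<longleftrightarrow> p \<noteq> [] \<and> distinct p \<and> pverts G = set p \<and>
     parcs G = set (vwalk_arcs p) \<union> (set (vwalk_arcs p))\<inverse>"

definition path_with_end_vertex :: "'a pair_pre_digraph \<Rightarrow> 'a \<Rightarrow> bool" where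
  "path_with_end_vertex G u \<longleftrightarrow>
     (\<exists>p. path_graph_along G p \<and> (u = hd p \<or> u = last p))"

end

theory Submission
  imports Defs
begin

text \<open>
  Write \<open>d\<^sub>1\<close>, \<open>d\<^sub>2\<close> for the distances of the factors.  The product consists of one copy (fibre) of
  \<open>G\<^sub>1\<close> over each vertex of \<open>G\<^sub>2\<close>, and the copies are joined only at their roots.  Hence the distance
  from \<open>(x\<^sub>2, x\<^sub>1)\<close> to \<open>(y\<^sub>2, y\<^sub>1)\<close> is \<open>d\<^sub>1 x\<^sub>1 y\<^sub>1\<close> inside a fibre and
  \<open>d\<^sub>1 x\<^sub>1 u\<^sub>1 + d\<^sub>2 x\<^sub>2 y\<^sub>2 + d\<^sub>1 u\<^sub>1 y\<^sub>1\<close> across fibres.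

  Lower bound: seen from another fibre, two vertices of one fibre differ only by their
  distances to the root.  So if \<open>W\<close> resolves the product, its trace on every fibre together with
  \<open>u\<^sub>1\<close> resolves \<open>G\<^sub>1\<close>; every trace is a rooted resolving set and \<open>W\<close> has at least
  \<open>card (pverts G\<^sub>2) * rdim\<close> elements.

  Upper bound: put a minimum rooted resolving set \<open>W\<^sub>1\<close> of \<open>G\<^sub>1\<close> into every fibre.  It is
  nonempty, because the root on its own resolves \<open>G\<^sub>1\<close> only if the vertices have distinct distances
  to it, which makes \<open>G\<^sub>1\<close> a path starting at \<open>u\<^sub>1\<close>.  Two vertices of one fibre are then resolved either
  inside that fibre, or, if only the root separates them, by a member of another fibre.  For two
  vertices \<open>(x\<^sub>2, a)\<close>, \<open>(y\<^sub>2, b)\<close> in different fibres and any \<open>w\<close> in \<open>W\<^sub>1\<close>, one of \<open>(x\<^sub>2, w)\<close> and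
  \<open>(y\<^sub>2, w)\<close> resolves: otherwise \<open>d\<^sub>1 a w + d\<^sub>1 b w\<close> would exceed
  \<open>(d\<^sub>1 a u\<^sub>1 + d\<^sub>1 u\<^sub>1 w) + (d\<^sub>1 b u\<^sub>1 + d\<^sub>1 u\<^sub>1 w)\<close> by the positive amount \<open>d\<^sub>2 x\<^sub>2 y\<^sub>2 + d\<^sub>2 y\<^sub>2 x\<^sub>2\<close>,
  against the triangle inequality.
\<close>

section \<open>Distances as natural numbers\<close>

definition walk_dist :: "'a pair_pre_digraph \<Rightarrow> 'a \<Rightarrow> 'a \<Rightarrow> nat" where
  "walk_dist G u v = (LEAST n. \<exists>p. pre_digraph.awalk (with_proj G) u p v \<and> length p = n)"

lemma (in wf_digraph) awalk_cost_unit: "awalk_cost (\<lambda>_. 1) p = real (length p)"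
  by (induction p) auto

lemma (in pair_wf_digraph) lipschitz_awalk:
  fixes f :: "'a \<Rightarrow> nat"
  assumes lip: "\<And>x y. (x, y) \<in> parcs G \<Longrightarrow> f x \<le> Suc (f y)"
    and "awalk x p v"
  shows "f x \<le> f v + length p"
  using assms(2)
proof (induction p arbitrary: x)
  case Nil
  then show ?case by (simp add: awalk_Nil_iff)
next
  case (Cons e p)
  then have "e \<in> parcs G" "fst e = x" and w: "awalk (snd e) p v"
    by (auto simp: awalk_Cons_iff)
  then have "f x \<le> Suc (f (snd e))"
    using lip by (metis prod.collapse)
  then show ?case using Cons.IH[OF w] by simp
qed

lemma (in pair_wf_digraph) descent_awalk:
  fixes f :: "'a \<Rightarrow> nat"
  assumes descent: "\<And>x. x \<in> pverts G \<Longrightarrow> x \<noteq> v \<Longrightarrow> \<exists>y. (x, y) \<in> parcs G \<and> f x = Suc (f y)"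
    and "f v = 0" and "x \<in> pverts G"
  shows "\<exists>p. awalk x p v \<and> length p = f x"
  using assms(3)
proof (induction "f x" arbitrary: x)
  case 0
  then have "x = v" using descent by fastforce
  then show ?case using 0 by (intro exI[of _ "[]"]) (simp add: awalk_Nil_iff)
next
  case (Suc n)
  then have "x \<noteq> v" using assms(2) by auto
  then obtain y where y: "(x, y) \<in> parcs G" "f x = Suc (f y)"
    using descent Suc.prems by blast
  then obtain p where "awalk y p v" "length p = f y"
    using Suc(1)[of y] Suc(2) in_arcsD2 by auto
  then show ?case using y Suc.prems
    by (intro exI[of _ "(x, y) # p"]) (simp add: awalk_Cons_iff)
qed

text \<open>
  A function that vanishes at \<open>v\<close>, changes by at most one along arcs, and can always be decreased
  by a step is the distance to \<open>v\<close>: the Lipschitz bound makes every walk long enough and greedy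
  descent gives a walk of exactly that length.  This yields distance formulas without analysing
  walks.
\<close>
lemma graph_dist_eqI:
  fixes f :: "'a \<Rightarrow> nat"
  assumes wf: "pair_wf_digraph G"
    and lip: "\<And>x y. (x, y) \<in> parcs G \<Longrightarrow> f x \<le> Suc (f y)"
    and descent: "\<And>x. x \<in> pverts G \<Longrightarrow> x \<noteq> v \<Longrightarrow> \<exists>y. (x, y) \<in> parcs G \<and> f x = Suc (f y)"
    and zero: "f v = 0" and x: "x \<in> pverts G"
  shows "graph_dist G x v = ereal (real (f x))"
proof -
  interpret pair_wf_digraph G by (rule wf)
  obtain p where p: "awalk x p v" "length p = f x"
    using descent_awalk[OF descent zero x] by blast
  have "\<mu> (\<lambda>_. 1) x v = ereal (real (f x))"
  proof (rule antisym)
    show "\<mu> (\<lambda>_. 1) x v \<le> ereal (real (f x))"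
      using min_cost_le_walk_cost[OF p(1), of "\<lambda>_. 1"] p(2) by (simp add: awalk_cost_unit)
    show "ereal (real (f x)) \<le> \<mu> (\<lambda>_. 1) x v"
      unfolding \<mu>_def
    proof (rule INF_greatest)
      fix q assume "q \<in> {p. awalk x p v}"
      then have "f x \<le> length q" using lipschitz_awalk[of f x q v, OF lip] zero by simp
      then show "ereal (real (f x)) \<le> ereal (awalk_cost (\<lambda>_. 1) q)"
        by (simp add: awalk_cost_unit)
    qed
  qed
  then show ?thesis by (simp add: graph_dist_def)
qed

locale connected_pair_graph =
  fixes G :: "'a pair_pre_digraph"
  assumes ncg: "nontrivial_connected_graph G"
begin

sublocale pair_graph G
  using ncg by (simp add: nontrivial_connected_graph_def)

abbreviation d where "d \<equiv> walk_dist G"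

lemma ex_awalk:
  assumes "u \<in> pverts G" "v \<in> pverts G"
  shows "\<exists>p. awalk u p v"
proof -
  have "strongly_connected (with_proj G)"
    using ncg symmetric_connected_imp_strongly_connected pair_sym_arcs
    by (simp add: nontrivial_connected_graph_def)
  then have "u \<rightarrow>\<^sup>*\<^bsub>with_proj G\<^esub> v"
    using assms by (simp add: strongly_connected_def)
  then show ?thesis by (simp add: reachable_awalk)
qed

lemma shortest_awalk:
  assumes "u \<in> pverts G" "v \<in> pverts G"
  obtains p where "awalk u p v" "length p = d u v"
proof -
  have "\<exists>n p. awalk u p v \<and> length p = n"
    using ex_awalk[OF assms] by blast
  from LeastI_ex[OF this] show ?thesis
    using that unfolding walk_dist_def by blast
qed

lemma walk_dist_le: "awalk u p v \<Longrightarrow> d u v \<le> length p"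
  unfolding walk_dist_def by (rule Least_le) blast

lemma walk_dist_self: "v \<in> pverts G \<Longrightarrow> d v v = 0"
  using walk_dist_le[of v "[]" v] by (simp add: awalk_Nil_iff)

lemma walk_dist_pos:
  assumes "u \<in> pverts G" "v \<in> pverts G" "u \<noteq> v"
  shows "0 < d u v"
proof -
  obtain p where "awalk u p v" "length p = d u v" using shortest_awalk assms by blast
  then show ?thesis using assms(3) by (cases p) (auto simp: awalk_Nil_iff)
qed

lemma walk_dist_lipschitz:
  assumes "(x, y) \<in> parcs G" "v \<in> pverts G"
  shows "d x v \<le> Suc (d y v)"
proof -
  have "y \<in> pverts G" using assms(1) by (rule in_arcsD2)
  then obtain p where p: "awalk y p v" "length p = d y v" using shortest_awalk assms(2) by blast
  then have "awalk x ((x, y) # p) v"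
    using assms(1) by (auto simp: awalk_Cons_iff intro: in_arcsD1)
  from walk_dist_le[OF this] show ?thesis using p by simp
qed

lemma walk_dist_descent:
  assumes "x \<in> pverts G" "v \<in> pverts G" "x \<noteq> v"
  shows "\<exists>y. (x, y) \<in> parcs G \<and> d x v = Suc (d y v)"
proof -
  obtain p where p: "awalk x p v" "length p = d x v" using shortest_awalk assms by blast
  then obtain e q where q: "p = e # q" using assms(3) by (cases p) (auto simp: awalk_Nil_iff)
  then have e: "(x, snd e) \<in> parcs G" and "awalk (snd e) q v"
    using p(1) by (auto simp: awalk_Cons_iff)
  then have "d (snd e) v \<le> length q" using walk_dist_le by blast
  then have "Suc (d (snd e) v) \<le> d x v" using p(2) q by simp
  with walk_dist_lipschitz[OF e assms(2)] e show ?thesis by (meson antisym)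
qed

lemma walk_dist_triangle:
  assumes "x \<in> pverts G" "v \<in> pverts G" "w \<in> pverts G"
  shows "d x w \<le> d x v + d v w"
proof -
  obtain p where p: "awalk x p v" "length p = d x v" using shortest_awalk assms by blast
  have "d x w \<le> d v w + length p"
    using lipschitz_awalk[of "\<lambda>x. d x w", OF walk_dist_lipschitz[OF _ assms(3)] p(1)] .
  then show ?thesis using p(2) by simp
qed

lemma graph_dist_eq_walk_dist:
  assumes "x \<in> pverts G" "v \<in> pverts G"
  shows "graph_dist G x v = ereal (real (d x v))"
  using assms walk_dist_lipschitz walk_dist_descent walk_dist_self
  by (intro graph_dist_eqI) (auto intro: pair_wf_digraph)

lemma resolving_set_iff:
  "resolving_set G W \<longleftrightarrow> W \<subseteq> pverts G \<and>
     (\<forall>a\<in>pverts G. \<forall>b\<in>pverts G. a \<noteq> b \<longrightarrow> (\<exists>w\<in>W. d a w \<noteq> d b w))"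
proof -
  have "W \<inter> resolvers G a b \<noteq> {} \<longleftrightarrow> (\<exists>w\<in>W. d a w \<noteq> d b w)"
    if "W \<subseteq> pverts G" "a \<in> pverts G" "b \<in> pverts G" for a b
    using that by (auto simp: resolvers_def graph_dist_eq_walk_dist disjoint_iff)
  then show ?thesis unfolding resolving_set_def by blast
qed

lemma rooted_resolving_set_iff:
  assumes "u \<in> pverts G"
  shows "rooted_resolving_set (G, u) W \<longleftrightarrow> W \<subseteq> pverts G \<and>
     (\<forall>a\<in>pverts G. \<forall>b\<in>pverts G. a \<noteq> b \<longrightarrow> d a u \<noteq> d b u \<or> (\<exists>w\<in>W. d a w \<noteq> d b w))"
  using assms
  by (auto simp: rooted_resolving_set_def underlying_def graph_root_def resolving_set_iff)

lemma rooted_resolving_set_pverts: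
  assumes "u \<in> pverts G"
  shows "rooted_resolving_set (G, u) (pverts G)"
  unfolding rooted_resolving_set_iff[OF assms]
  by (metis order_refl walk_dist_pos walk_dist_self less_numeral_extra(3))

lemma rooted_metric_dim_attained:
  assumes "u \<in> pverts G"
  obtains W where "rooted_resolving_set (G, u) W" "card W = rooted_metric_dim (G, u)"
proof -
  have "\<exists>n W. rooted_resolving_set (G, u) W \<and> card W = n"
    using rooted_resolving_set_pverts[OF assms] by blast
  from LeastI_ex[OF this] show ?thesis
    using that unfolding rooted_metric_dim_def by blast
qed

end

lemma rooted_metric_dim_le:
  "rooted_resolving_set R W \<Longrightarrow> rooted_metric_dim R \<le> card W"
  unfolding rooted_metric_dim_def by (rule Least_le) blast


section \<open>Graphs resolved by their root alone\<close>

lemma down_closed_eq_lessThan: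
  fixes S :: "nat set"
  assumes "finite S" and down: "\<And>n. Suc n \<in> S \<Longrightarrow> n \<in> S"
  shows "S = {..<card S}"
proof (cases "S = {}")
  case False
  have "n \<in> S" if "n \<le> Max S" for n
    using that Max_in[OF assms(1) False] by (induction rule: inc_induct) (auto intro: down)
  then have "{..Max S} \<subseteq> S" by auto
  then have "S = {..Max S}" using assms(1) by auto
  then show ?thesis by (metis card_atMost lessThan_Suc_atMost)
qed simp

lemma set_vwalk_arcs_conv_nth:
  "set (vwalk_arcs p) = {(p ! i, p ! Suc i) | i. Suc i < length p}"
proof (induction p rule: vwalk_arcs.induct)
  case (3 x y xs)
  have "{i. Suc i < length (x # y # xs)} = insert 0 (Suc ` {i. Suc i < length (y # xs)})"
    by (auto simp: image_iff less_Suc_eq_0_disj)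
  then show ?case using 3 by (simp add: setcompr_eq_image image_image)
qed auto

text \<open>
  Injective distances to \<open>u\<close> take exactly the values \<open>0, \<dots>, n - 1\<close>, since each vertex other than \<open>u\<close>
  has a neighbour one step closer.  Listed by distance, each vertex is adjacent to its predecessor,
  and there are no other edges because adjacent vertices have distances differing by at most one.
\<close>
lemma (in connected_pair_graph) path_if_root_resolves:
  assumes u: "u \<in> pverts G" and inj: "inj_on (\<lambda>x. d x u) (pverts G)"
  shows "path_with_end_vertex G u"
proof -
  let ?V = "pverts G" and ?f = "\<lambda>x. d x u"
  let ?n = "card ?V"
  have fin: "finite ?V" by (rule pair_finite_verts)
  have "?f ` ?V = {..<card (?f ` ?V)}"
  proof (rule down_closed_eq_lessThan)
    fix n assume "Suc n \<in> ?f ` ?V"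
    then obtain x where x: "x \<in> ?V" "?f x = Suc n" by fastforce
    then have "x \<noteq> u" using walk_dist_self u by auto
    then obtain y where "(x, y) \<in> parcs G" "?f x = Suc (?f y)"
      using walk_dist_descent[OF x(1) u] by blast
    then show "n \<in> ?f ` ?V" using x in_arcsD2 by (metis image_iff nat.inject)
  qed (use fin in simp)
  then have img: "?f ` ?V = {..<?n}" using card_image[OF inj] by simp
  define g where "g = inv_into ?V ?f"
  have gV: "g i \<in> ?V" and fg: "?f (g i) = i" if "i < ?n" for i
    using that img inv_into_into[of i ?f ?V] f_inv_into_f[of i ?f ?V] unfolding g_def by auto
  have gf: "g (?f x) = x" and fn: "?f x < ?n" if "x \<in> ?V" for x
    using inv_into_f_f[OF inj that] that img unfolding g_def by auto
  have n0: "0 < ?n" using fin u card_gt_0_iff by blast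
  define p where "p = map g [0..<?n]"
  have "p \<noteq> []" using fin u by (auto simp: p_def)
  moreover have "distinct p"
    unfolding p_def distinct_map using fg by (auto intro!: inj_onI) metis
  moreover have "?V = set p"
    unfolding p_def using gV gf fn by (auto simp: image_iff) (metis atLeast0LessThan lessThan_iff)
  moreover have "parcs G = set (vwalk_arcs p) \<union> (set (vwalk_arcs p))\<inverse>"
  proof -
    have arcs_p: "set (vwalk_arcs p) = {(g i, g (Suc i)) | i. Suc i < ?n}"
      unfolding set_vwalk_arcs_conv_nth
      by (intro Collect_cong ex_cong1) (auto simp: p_def)
    have adj: "(g (Suc i), g i) \<in> parcs G" if i: "Suc i < ?n" for i
    proof -
      have "g (Suc i) \<noteq> u" using fg[OF i] walk_dist_self[OF u] by auto
      then obtain y where y: "(g (Suc i), y) \<in> parcs G" "?f (g (Suc i)) = Suc (?f y)"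
        using walk_dist_descent[OF gV[OF i] u] by blast
      then have "?f y = i" using fg[OF i] by simp
      then have "y = g i" using gf in_arcsD2[OF y(1)] by auto
      then show ?thesis using y by simp
    qed
    have step: "(x, y) \<in> {(g i, g (Suc i)) | i. Suc i < ?n}"
      if xy: "(x, y) \<in> parcs G" "?f x < ?f y" for x y
    proof -
      have "(y, x) \<in> parcs G" using xy arcs_symmetric by blast
      then have "?f y = Suc (?f x)" using walk_dist_lipschitz[OF _ u, of y x] xy by simp
      moreover have "x \<in> ?V" "y \<in> ?V" using xy in_arcsD1 in_arcsD2 by blast+
      ultimately show ?thesis using gf fn by (metis (mono_tags, lifting) mem_Collect_eq)
    qed
    have ne: "?f x \<noteq> ?f y" if "(x, y) \<in> parcs G" for x y
      using that inj no_loops' in_arcsD1 in_arcsD2 by (metis inj_on_def)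
    show ?thesis unfolding arcs_p
    proof (intro subset_antisym subrelI)
      fix x y assume xy: "(x, y) \<in> parcs G"
      then have yx: "(y, x) \<in> parcs G" using arcs_symmetric by blast
      show "(x, y) \<in> {(g i, g (Suc i)) |i. Suc i < ?n} \<union> {(g i, g (Suc i)) |i. Suc i < ?n}\<inverse>"
        using step[OF xy] step[OF yx] ne[OF xy] by (cases "?f x < ?f y") auto
    next
      fix x y
      assume "(x, y) \<in> {(g i, g (Suc i)) |i. Suc i < ?n} \<union> {(g i, g (Suc i)) |i. Suc i < ?n}\<inverse>"
      then show "(x, y) \<in> parcs G" using adj arcs_symmetric by auto
    qed
  qed
  moreover have "hd p = u"
    using n0 gf[OF u] walk_dist_self[OF u] by (simp add: p_def upt_conv_Cons)
  ultimately show ?thesis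
    unfolding path_with_end_vertex_def path_graph_along_def by blast
qed

lemma (in connected_pair_graph) rooted_resolving_set_nonempty:
  assumes "u \<in> pverts G" "\<not> path_with_end_vertex G u" "rooted_resolving_set (G, u) W"
  shows "W \<noteq> {}"
proof
  assume "W = {}"
  then have "inj_on (\<lambda>x. d x u) (pverts G)"
    using assms(3) by (auto simp: rooted_resolving_set_iff[OF assms(1)] inj_on_def)
  then show False using path_if_root_resolves assms by blast
qed


section \<open>The hierarchical product\<close>

locale hierarchical_factors =
  G1: connected_pair_graph G1 + G2: connected_pair_graph G2
  for G1 :: "'a pair_pre_digraph" and G2 :: "'b pair_pre_digraph" +
  fixes u1 :: 'a and u2 :: 'b
  assumes u1: "u1 \<in> pverts G1"
begin

abbreviation P :: "('b \<times> 'a) pair_pre_digraph" where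
  "P \<equiv> underlying (hierarchical_product (G2, u2) (G1, u1))"

lemma pverts_P: "pverts P = pverts G2 \<times> pverts G1"
  by (simp add: underlying_def hierarchical_product_def)

lemma parcs_P_iff:
  "((x2, x1), (y2, y1)) \<in> parcs P \<longleftrightarrow>
     x2 \<in> pverts G2 \<and> x2 = y2 \<and> (x1, y1) \<in> parcs G1 \<or>
     x1 = u1 \<and> y1 = u1 \<and> (x2, y2) \<in> parcs G2"
  by (simp add: underlying_def graph_root_def hierarchical_product_def)

lemma pair_wf_P: "pair_wf_digraph P"
proof
  fix e assume e: "e \<in> parcs P"
  obtain x2 x1 y2 y1 where [simp]: "e = ((x2, x1), (y2, y1))" by (metis prod.exhaust)
  show "fst e \<in> pverts P" "snd e \<in> pverts P"
    using e u1 by (auto simp: pverts_P parcs_P_iff dest: G1.in_arcsD1 G1.in_arcsD2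
      G2.in_arcsD1 G2.in_arcsD2)
qed

fun prod_dist :: "'b \<times> 'a \<Rightarrow> 'b \<times> 'a \<Rightarrow> nat" where
  "prod_dist (x2, x1) (y2, y1) =
     (if x2 = y2 then G1.d x1 y1 else G1.d x1 u1 + G2.d x2 y2 + G1.d u1 y1)"

text \<open>
  At the roots \<open>(x2, u1)\<close> of the fibres both branches of the distance formula agree with
  \<open>G2.d x2 y2 + G1.d u1 y1\<close>, so arcs between fibres behave as in \<open>G2\<close>.
\<close>
lemma prod_dist_root:
  assumes "y2 \<in> pverts G2"
  shows "prod_dist (x2, u1) (y2, y1) = G2.d x2 y2 + G1.d u1 y1"
  using assms u1 by (simp add: G1.walk_dist_self G2.walk_dist_self)

lemma graph_dist_P:
  assumes "x \<in> pverts P" "y \<in> pverts P"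
  shows "graph_dist P x y = ereal (real (prod_dist x y))"
proof -
  obtain y2 y1 where y: "y = (y2, y1)" "y2 \<in> pverts G2" "y1 \<in> pverts G1"
    using assms(2) by (auto simp: pverts_P)
  show ?thesis
  proof (rule graph_dist_eqI[OF pair_wf_P _ _ _ assms(1)])
    fix a b assume ab: "(a, b) \<in> parcs P"
    obtain a2 a1 b2 b1 where s: "a = (a2, a1)" "b = (b2, b1)" by (metis prod.exhaust)
    consider "a2 = b2" "(a1, b1) \<in> parcs G1" | "a1 = u1" "b1 = u1" "(a2, b2) \<in> parcs G2"
      using ab s by (auto simp: parcs_P_iff)
    then show "prod_dist a y \<le> Suc (prod_dist b y)"
    proof cases
      case 1
      then show ?thesis
        using G1.walk_dist_lipschitz[OF 1(2) y(3)] G1.walk_dist_lipschitz[OF 1(2) u1] s y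
        by auto
    next
      case 2
      then show ?thesis
        using G2.walk_dist_lipschitz[OF 2(3) y(2)] unfolding s y(1)
        by (simp only: prod_dist_root[OF y(2)] add_Suc[symmetric] add_le_mono1)
    qed
  next
    fix a assume a: "a \<in> pverts P" "a \<noteq> y"
    obtain a2 a1 where s: "a = (a2, a1)" "a2 \<in> pverts G2" "a1 \<in> pverts G1"
      using a by (auto simp: pverts_P)
    consider (fibre) "a2 = y2" "a1 \<noteq> y1" | (to_root) "a2 \<noteq> y2" "a1 \<noteq> u1"
      | (at_root) "a2 \<noteq> y2" "a1 = u1"
      using a s y by auto
    then show "\<exists>b. (a, b) \<in> parcs P \<and> prod_dist a y = Suc (prod_dist b y)"
    proof cases
      case fibre
      then obtain b1 where "(a1, b1) \<in> parcs G1" "G1.d a1 y1 = Suc (G1.d b1 y1)"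
        using G1.walk_dist_descent s y by blast
      then show ?thesis using fibre s y
        by (intro exI[of _ "(a2, b1)"]) (auto simp: parcs_P_iff)
    next
      case to_root
      then obtain b1 where "(a1, b1) \<in> parcs G1" "G1.d a1 u1 = Suc (G1.d b1 u1)"
        using G1.walk_dist_descent s u1 by blast
      then show ?thesis using to_root s y
        by (intro exI[of _ "(a2, b1)"]) (auto simp: parcs_P_iff)
    next
      case at_root
      then obtain b2 where "(a2, b2) \<in> parcs G2" "G2.d a2 y2 = Suc (G2.d b2 y2)"
        using G2.walk_dist_descent s y by blast
      then show ?thesis using at_root s y
        by (intro exI[of _ "(b2, u1)"])
          (simp only: parcs_P_iff prod_dist_root add_Suc simp_thms)
    qed
  next
    show "prod_dist y y = 0" using y by (simp add: G1.walk_dist_self)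
  qed
qed

lemma resolving_set_P_iff:
  "resolving_set P W \<longleftrightarrow> W \<subseteq> pverts P \<and>
     (\<forall>x\<in>pverts P. \<forall>y\<in>pverts P. x \<noteq> y \<longrightarrow> (\<exists>w\<in>W. prod_dist x w \<noteq> prod_dist y w))"
proof -
  have "W \<inter> resolvers P x y \<noteq> {} \<longleftrightarrow> (\<exists>w\<in>W. prod_dist x w \<noteq> prod_dist y w)"
    if "W \<subseteq> pverts P" "x \<in> pverts P" "y \<in> pverts P" for x y
  proof -
    have "w \<in> resolvers P x y \<longleftrightarrow> prod_dist x w \<noteq> prod_dist y w" if "w \<in> W" for w
      using that \<open>W \<subseteq> pverts P\<close> \<open>x \<in> pverts P\<close> \<open>y \<in> pverts P\<close>
      by (auto simp only: resolvers_def graph_dist_P mem_Collect_eq subset_iff ereal.inject of_nat_eq_iff)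
    then show ?thesis by blast
  qed
  then show ?thesis unfolding resolving_set_def by blast
qed

text \<open>
  A member of \<open>W\<close> outside the fibre over \<open>z\<close> reaches that fibre only through its root, so a pair
  of vertices of the fibre that it resolves is resolved by the root as well.
\<close>
lemma fibre_rooted_resolving:
  assumes W: "resolving_set P W" and z: "z \<in> pverts G2"
  shows "rooted_resolving_set (G1, u1) (W `` {z})"
  unfolding G1.rooted_resolving_set_iff[OF u1]
proof (intro conjI ballI impI)
  show "W `` {z} \<subseteq> pverts G1" using W by (auto simp: resolving_set_P_iff pverts_P)
  fix a b assume ab: "a \<in> pverts G1" "b \<in> pverts G1" "a \<noteq> b"
  then have "\<exists>w\<in>W. prod_dist (z, a) w \<noteq> prod_dist (z, b) w"
    using W z unfolding resolving_set_P_iff pverts_P by blast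
  then obtain w2 w1 where "(w2, w1) \<in> W" "prod_dist (z, a) (w2, w1) \<noteq> prod_dist (z, b) (w2, w1)"
    by auto
  then show "G1.d a u1 \<noteq> G1.d b u1 \<or> (\<exists>w\<in>W `` {z}. G1.d a w \<noteq> G1.d b w)"
    by (cases "z = w2") auto
qed

lemma card_resolving_set_ge:
  assumes W: "resolving_set P W"
  shows "card (pverts G2) * rooted_metric_dim (G1, u1) \<le> card W"
proof -
  have sub: "W \<subseteq> pverts G2 \<times> pverts G1" using W by (simp add: resolving_set_P_iff pverts_P)
  then have fin: "finite (W `` {z})" for z
    using G1.pair_finite_verts finite_subset[of "W `` {z}" "pverts G1"] by blast
  have "W = Sigma (pverts G2) (\<lambda>z. W `` {z})" using sub by auto
  then have "card W = card (Sigma (pverts G2) (\<lambda>z. W `` {z}))" by simp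
  also have "\<dots> = (\<Sum>z\<in>pverts G2. card (W `` {z}))"
    using G2.pair_finite_verts fin by simp
  also have "\<dots> \<ge> (\<Sum>z\<in>pverts G2. rooted_metric_dim (G1, u1))"
    using fibre_rooted_resolving[OF W] by (intro sum_mono rooted_metric_dim_le)
  finally show ?thesis by simp
qed

text \<open>
  Two vertices of one fibre that only the root separates are resolved from outside: \<open>G2\<close> has a
  second vertex, and a member of the copy of \<open>W1\<close> over it sees the different distances to the root.
  Vertices of different fibres are resolved by the two copies of a single \<open>w\<close> in their fibres,
  since adding the two equalities that would fail to separate them contradicts the triangle
  inequality.
\<close>
lemma resolving_set_Times:
  assumes W1: "rooted_resolving_set (G1, u1) W1" and ne: "W1 \<noteq> {}"
  shows "resolving_set P (pverts G2 \<times> W1)"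
proof -
  have sub: "W1 \<subseteq> pverts G1"
    and res: "\<And>a b. a \<in> pverts G1 \<Longrightarrow> b \<in> pverts G1 \<Longrightarrow> a \<noteq> b \<Longrightarrow>
      G1.d a u1 \<noteq> G1.d b u1 \<or> (\<exists>w\<in>W1. G1.d a w \<noteq> G1.d b w)"
    using W1 by (auto simp: G1.rooted_resolving_set_iff[OF u1])
  obtain w where w: "w \<in> W1" "w \<in> pverts G1" using ne sub by blast
  have "\<exists>v\<in>pverts G2 \<times> W1. prod_dist (x2, a) v \<noteq> prod_dist (y2, b) v"
    if V: "x2 \<in> pverts G2" "a \<in> pverts G1" "y2 \<in> pverts G2" "b \<in> pverts G1"
      and neq: "(x2, a) \<noteq> (y2, b)" for x2 a y2 b
  proof (cases "x2 = y2")
    case True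
    then have "G1.d a u1 \<noteq> G1.d b u1 \<or> (\<exists>w\<in>W1. G1.d a w \<noteq> G1.d b w)"
      using res V neq by blast
    then show ?thesis
    proof
      assume root: "G1.d a u1 \<noteq> G1.d b u1"
      have "pverts G2 \<noteq> {x2}"
        using G2.ncg by (auto simp: nontrivial_connected_graph_def)
      then obtain z where z: "z \<in> pverts G2" "z \<noteq> x2" using V(1) by blast
      show ?thesis using root z w True by (intro bexI[of _ "(z, w)"]) auto
    next
      assume "\<exists>w\<in>W1. G1.d a w \<noteq> G1.d b w"
      then show ?thesis using True V by auto
    qed
  next
    case False
    have "G1.d a w \<le> G1.d a u1 + G1.d u1 w" "G1.d b w \<le> G1.d b u1 + G1.d u1 w"
      using G1.walk_dist_triangle V w u1 by blast+
    moreover have "0 < G2.d x2 y2" using G2.walk_dist_pos V False by blast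
    ultimately have "prod_dist (x2, a) (x2, w) \<noteq> prod_dist (y2, b) (x2, w) \<or>
        prod_dist (x2, a) (y2, w) \<noteq> prod_dist (y2, b) (y2, w)"
      using False by auto
    then show ?thesis using V w by blast
  qed
  then show ?thesis using sub unfolding resolving_set_P_iff pverts_P by blast
qed

end

theorem theorem2p7:
  fixes G1 :: "'a pair_pre_digraph" and u1 :: 'a
    and G2 :: "'b pair_pre_digraph" and u2 :: 'b
  assumes "nontrivial_connected_graph G1" and "u1 \<in> pverts G1"
    and "nontrivial_connected_graph G2" and "u2 \<in> pverts G2"
    and "\<not> path_with_end_vertex G1 u1"
  shows "metric_dim (underlying (hierarchical_product (G2, u2) (G1, u1))) =
           card (pverts G2) * rooted_metric_dim (G1, u1)"
proof -
  interpret hierarchical_factors G1 G2 u1 u2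
    using assms by unfold_locales
  obtain W1 where W1: "rooted_resolving_set (G1, u1) W1" "card W1 = rooted_metric_dim (G1, u1)"
    using G1.rooted_metric_dim_attained[OF u1] .
  then have "W1 \<noteq> {}" using G1.rooted_resolving_set_nonempty u1 assms(5) by blast
  then have "resolving_set P (pverts G2 \<times> W1)" using resolving_set_Times W1(1) by blast
  moreover have "card (pverts G2 \<times> W1) = card (pverts G2) * rooted_metric_dim (G1, u1)"
    using W1(2) by (simp add: card_cartesian_product)
  ultimately show ?thesis
    unfolding metric_dim_def using card_resolving_set_ge by (intro Least_equality) blast+
qed

end
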